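(* There exists an adaptive deterministic algorithm that solves the Graph Reconstruction problem with a CC oracle using $\mathcal{O}\big(d^3\log(n)\log(n/d)\big)$ CC queries when the degeneracy $d$ of the hidden graph is known, where $n$ is the number of vertices.
   Context: Graph Reconstruction (GR): an unknown ("hidden") simple undirected graph $G=(V,E)$ on a known vertex set $V$ with $|V|=n$ is to be determined, i.e. the algorithm must output $E$. A CC oracle, on query $S\subseteq V$, returns the partition of $S$ into the vertex sets of the connected components of the induced subgraph $G[S]$; complexity is the number of queries. A deterministic algorithm must always output the hidden graph. The degeneracy of a graph is the smallest integer $d$ such that every induced subgraph has a vertex of degree at most $d$. *)

theory Defs
  imports "HOL-Analysis.Analysis"
begin

definition simple_graph :: "'a set \<Rightarrow> 'a set set \<Rightarrow> bool" where
  "simple_graph V E \<longleftrightarrow> finite V \<and> (\<forall>e\<in>E. e \<subseteq> V \<and> card e = 2)"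

definition induced_edges :: "'a set set \<Rightarrow> 'a set \<Rightarrow> 'a set set" where
  "induced_edges E S = {e \<in> E. e \<subseteq> S}"

definition vertex_degree :: "'a set set \<Rightarrow> 'a \<Rightarrow> nat" where
  "vertex_degree E v = card {e \<in> E. v \<in> e}"

(* Only nonempty induced subgraphs are considered: the empty one has no vertex at all. *)
definition degeneracy :: "'a set \<Rightarrow> 'a set set \<Rightarrow> nat" where
  "degeneracy V E =
     (LEAST d. \<forall>S\<subseteq>V. S \<noteq> {} \<longrightarrow> (\<exists>v\<in>S. vertex_degree (induced_edges E S) v \<le> d))"

definition connected_in :: "'a set \<Rightarrow> 'a set set \<Rightarrow> ('a \<times> 'a) set" where
  "connected_in S F = {(u, v). u \<in> S \<and> v \<in> S \<and> (u, v) \<in> {(x, y). {x, y} \<in> F}\<^sup>*}"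

definition connected_components :: "'a set \<Rightarrow> 'a set set \<Rightarrow> 'a set set" where
  "connected_components S F = S // connected_in S F"

definition cc_oracle :: "'a set set \<Rightarrow> 'a set \<Rightarrow> 'a set set" where
  "cc_oracle E S = connected_components S (induced_edges E S)"

(* A deterministic adaptive algorithm is a decision tree: a leaf outputs an edge set, and an
   inner node asks a query and continues in a way that depends on the answer.  Every branch of
   such a tree is finite. *)
datatype 'a cc_algorithm =
    Output "'a set set"
  | Query "'a set" "'a set set \<Rightarrow> 'a cc_algorithm"

primrec alg_output :: "('a set \<Rightarrow> 'a set set) \<Rightarrow> 'a cc_algorithm \<Rightarrow> 'a set set" where
  "alg_output orc (Output F) = F"
| "alg_output orc (Query S k) = alg_output orc (k (orc S))"

primrec alg_queries :: "('a set \<Rightarrow> 'a set set) \<Rightarrow> 'a cc_algorithm \<Rightarrow> 'a set list" where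
  "alg_queries orc (Output F) = []"
| "alg_queries orc (Query S k) = S # alg_queries orc (k (orc S))"

definition reconstructs :: "'a cc_algorithm \<Rightarrow> 'a set \<Rightarrow> 'a set set \<Rightarrow> bool" where
  "reconstructs A V E \<longleftrightarrow>
     (\<forall>S \<in> set (alg_queries (cc_oracle E) A). S \<subseteq> V) \<and> alg_output (cc_oracle E) A = E"

definition num_queries :: "'a cc_algorithm \<Rightarrow> 'a set set \<Rightarrow> nat" where
  "num_queries A E = length (alg_queries (cc_oracle E) A)"

end

theory Submission
  imports Defs
begin

text \<open>
  A graph of degeneracy \<open>d\<close> on \<open>m\<close> vertices has at most \<open>d m\<close> edges, so at least half of its vertices
  have degree at most \<open>4 d\<close>.  A query that contains \<open>u\<close> and \<open>v\<close> but no neighbour of \<open>v\<close> shows \<open>v\<close>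
  isolated and certifies that \<open>u\<close> and \<open>v\<close> are not adjacent.  There is a family of
  \<open>O(d\<^sup>3 log n)\<close> sets that contains such a query for all non-adjacent \<open>u\<close>, \<open>v\<close> with \<open>v\<close> of degree at
  most \<open>4 d\<close>: a random set containing each vertex with probability \<open>1 / (8 d)\<close> serves a given
  \<open>u\<close>, \<open>v\<close> and neighbourhood with probability at least \<open>1 / (128 d\<^sup>2)\<close>, and there are at most
  \<open>n ^ (4 d + 3)\<close> of these.  The pairs left uncertified contain all edges, and they are
  exactly the edges at every vertex that lies in at most \<open>4 d\<close> of them.  Removing these vertices halves
  the vertex set; after \<open>log (n / d)\<close> rounds fewer than \<open>2 d\<close> vertices remain, whose pairs are
  queried one by one.
\<close>

section \<open>Isolating families\<close>

text \<open>Derandomises a union bound: double counting gives an \<open>x\<close> that serves at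
  least the average share of the requirements still open, so each greedy choice shrinks them by a
  factor \<open>1 - \<delta>\<close>.\<close>

lemma greedy_cover:
  fixes P :: "'x \<Rightarrow> 'r \<Rightarrow> bool" and \<delta> :: real
  assumes "finite X" "X \<noteq> {}" "finite R" "\<delta> \<le> 1"
    and cov: "\<And>r. r \<in> R \<Longrightarrow> \<delta> * card X \<le> card {x \<in> X. P x r}"
  shows "\<exists>xs. set xs \<subseteq> X \<and> length xs = t \<and>
    card {r \<in> R. \<forall>x \<in> set xs. \<not> P x r} \<le> (1 - \<delta>) ^ t * card R"
proof (induction t)
  case 0
  then show ?case by simp
next
  case (Suc t)
  then obtain xs where xs: "set xs \<subseteq> X" "length xs = t"
    and le: "card {r \<in> R. \<forall>x \<in> set xs. \<not> P x r} \<le> (1 - \<delta>) ^ t * card R" by blast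
  define R' where "R' = {r \<in> R. \<forall>x \<in> set xs. \<not> P x r}"
  have fR': "finite R'" using assms(3) by (simp add: R'_def)
  have "\<exists>x\<in>X. \<delta> * card R' \<le> card {r \<in> R'. P x r}"
  proof (rule ccontr)
    assume "\<not> ?thesis"
    then have less: "\<And>x. x \<in> X \<Longrightarrow> real (card {r \<in> R'. P x r}) < \<delta> * card R'"
      by force
    have swap: "(\<Sum>x\<in>X. card {r \<in> R'. P x r}) = (\<Sum>r\<in>R'. card {x \<in> X. P x r})"
      using assms(1) fR' by (rule sum_multicount_gen) simp
    have "(\<Sum>x\<in>X. real (card {r \<in> R'. P x r})) < (\<Sum>x\<in>X. \<delta> * card R')"
      using less assms(1,2) by (intro sum_strict_mono) auto
    also have "\<dots> = (\<Sum>r\<in>R'. \<delta> * card X)" by simp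
    also have "\<dots> \<le> (\<Sum>r\<in>R'. real (card {x \<in> X. P x r}))"
      by (intro sum_mono cov) (simp add: R'_def)
    also have "\<dots> = (\<Sum>x\<in>X. real (card {r \<in> R'. P x r}))"
      by (simp only: swap flip: of_nat_sum)
    finally show False by simp
  qed
  then obtain x where x: "x \<in> X" "\<delta> * card R' \<le> card {r \<in> R'. P x r}" by blast
  have eq: "{r \<in> R. \<forall>y \<in> set (x # xs). \<not> P y r} = R' - {r \<in> R'. P x r}"
    by (auto simp: R'_def)
  have "real (card (R' - {r \<in> R'. P x r})) = card R' - card {r \<in> R'. P x r}"
    using fR' by (subst card_Diff_subset) (auto simp: of_nat_diff card_mono)
  also have "\<dots> = real (card R') - card {r \<in> R'. P x r}"
    using fR' by (simp add: of_nat_diff card_mono)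
  also have "\<dots> \<le> (1 - \<delta>) * card R'" using x(2) by (simp add: algebra_simps)
  also have "\<dots> \<le> (1 - \<delta>) * ((1 - \<delta>) ^ t * card R)"
    using le assms(4) by (intro mult_left_mono) (auto simp: R'_def)
  finally have "card {r \<in> R. \<forall>y \<in> set (x # xs). \<not> P y r} \<le> (1 - \<delta>) ^ Suc t * card R"
    by (simp only: eq) (simp add: algebra_simps)
  then show ?case
    using xs x(1) by (intro exI[of _ "x # xs"]) auto
qed

text \<open>\<open>N\<close> stands for the neighbourhood of \<open>v\<close>. Quantifying over
  every small \<open>N\<close> makes the family independent of the hidden graph, so it can be fixed
  before any query.\<close>

definition isolating_family :: "'a set \<Rightarrow> nat \<Rightarrow> 'a set list \<Rightarrow> bool" where
  "isolating_family V D Ss \<longleftrightarrow>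
     (\<forall>u\<in>V. \<forall>v\<in>V. \<forall>N \<subseteq> V - {u, v}. u \<noteq> v \<and> card N \<le> D \<longrightarrow>
       (\<exists>S \<in> set Ss. u \<in> S \<and> v \<in> S \<and> S \<inter> N = {}))"

text \<open>Each such subset is the set of a list of length at most \<open>D\<close>; with base at
  least 2 the geometric sum of the list counts does not exceed the next power.\<close>

lemma card_bounded_subsets_le:
  assumes "finite V" "2 \<le> card V"
  shows "card {N. N \<subseteq> V \<and> card N \<le> D} \<le> card V ^ Suc D"
proof -
  have sub: "{N. N \<subseteq> V \<and> card N \<le> D} \<subseteq> set ` {xs. set xs \<subseteq> V \<and> length xs \<le> D}"
  proof
    fix N assume N: "N \<in> {N. N \<subseteq> V \<and> card N \<le> D}"
    then obtain xs where "set xs = N" "distinct xs"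
      using assms(1) finite_distinct_list finite_subset by blast
    then show "N \<in> set ` {xs. set xs \<subseteq> V \<and> length xs \<le> D}"
      using N by (auto simp: distinct_card[symmetric] intro!: image_eqI[of _ _ xs])
  qed
  have "card {N. N \<subseteq> V \<and> card N \<le> D} \<le> card {xs. set xs \<subseteq> V \<and> length xs \<le> D}"
    by (rule surj_card_le[OF finite_lists_length_le[OF assms(1)] sub])
  also have "\<dots> = (\<Sum>i\<le>D. card V ^ i)"
    by (rule card_lists_length_le[OF assms(1)])
  also have "\<dots> \<le> card V ^ Suc D"
  proof (induction D)
    case 0
    then show ?case using assms(2) by simp
  next
    case (Suc D)
    have "(\<Sum>i\<le>Suc D. card V ^ i) \<le> 2 * card V ^ Suc D" using Suc by simp
    also have "\<dots> \<le> card V ^ Suc (Suc D)" using assms(2) by simp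
    finally show ?case .
  qed
  finally show ?thesis .
qed

text \<open>A colouring with \<open>2 D\<close> colours stands for its colour class \<open>0\<close>, which is a random set of
  density \<open>1 / (2 D)\<close>.\<close>

lemma card_isolating_colourings:
  assumes V: "finite V" "u \<in> V" "v \<in> V" "u \<noteq> v" "N \<subseteq> V - {u, v}" "card N \<le> D" "1 \<le> D"
  shows "1 / (8 * real D ^ 2) * card (V \<rightarrow>\<^sub>E {..<2 * D}) \<le>
    card {f \<in> V \<rightarrow>\<^sub>E {..<2 * D}. f u = 0 \<and> f v = 0 \<and> (\<forall>w\<in>N. f w \<noteq> 0)}"
proof -
  \<comment> \<open>The colours allowed at each vertex. The box \<open>Pi\<^sub>E V A\<close>
    consists of good colourings, and its share of all colourings is a product over the
    vertices.\<close>
  define A where "A w = (if w \<in> {u, v} then {0} else if w \<in> N then {1..<2 * D} else {..<2 * D})" for w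
  have sub: "Pi\<^sub>E V A \<subseteq> {f \<in> V \<rightarrow>\<^sub>E {..<2 * D}. f u = 0 \<and> f v = 0 \<and> (\<forall>w\<in>N. f w \<noteq> 0)}"
  proof
    fix f assume f: "f \<in> Pi\<^sub>E V A"
    have "A w \<subseteq> {..<2 * D}" for w using V(7) by (auto simp: A_def)
    then have 1: "f \<in> V \<rightarrow>\<^sub>E {..<2 * D}" using f by (meson PiE_mono subsetD)
    have "f w \<in> A w" if "w \<in> V" for w using f that by auto
    then have "f u \<in> A u" "f v \<in> A v" "\<And>w. w \<in> N \<Longrightarrow> f w \<in> A w" using V by auto
    moreover have "0 \<notin> A w" if "w \<in> N" for w using that V(5) by (auto simp: A_def)
    moreover have "A u = {0}" "A v = {0}" by (simp_all add: A_def)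
    ultimately have "f u = 0" "f v = 0" "\<And>w. w \<in> N \<Longrightarrow> f w \<noteq> 0"
      by force+
    then show "f \<in> {f \<in> V \<rightarrow>\<^sub>E {..<2 * D}. f u = 0 \<and> f v = 0 \<and> (\<forall>w\<in>N. f w \<noteq> 0)}" using 1 by simp
  qed
  define q where "q = 2 * real D"
  have q: "q \<ge> 2" using V(7) by (simp add: q_def)
  have "(\<Prod>w\<in>V. real (card (A w)) / q) =
      (\<Prod>w\<in>V - {u, v}. real (card (A w)) / q) * (\<Prod>w\<in>{u, v}. real (card (A w)) / q)"
    using V by (intro prod.subset_diff) auto
  also have "(\<Prod>w\<in>V - {u, v}. real (card (A w)) / q) =
      (\<Prod>w\<in>V - {u, v} - N. real (card (A w)) / q) * (\<Prod>w\<in>N. real (card (A w)) / q)"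
    using V by (intro prod.subset_diff) auto
  also have "(\<Prod>w\<in>{u, v}. real (card (A w)) / q) = 1 / q ^ 2"
    using V(4) by (simp add: A_def power2_eq_square)
  also have "(\<Prod>w\<in>N. real (card (A w)) / q) = (\<Prod>w\<in>N. 1 - 1 / q)"
  proof (rule prod.cong)
    fix w assume "w \<in> N"
    then have "A w = {1..<2 * D}" using V(5) by (auto simp: A_def)
    then have "real (card (A w)) = q - 1" using V(7) by (simp add: q_def of_nat_diff)
    then show "real (card (A w)) / q = 1 - 1 / q" using q by (simp add: field_simps)
  qed simp
  also have "(\<Prod>w\<in>V - {u, v} - N. real (card (A w)) / q) = 1"
    by (rule prod.neutral) (use V(7) in \<open>auto simp: A_def q_def\<close>)
  also have "(\<Prod>w\<in>N. 1 - 1 / q) = (1 - 1 / q) ^ card N" by simp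
  finally have prod: "(\<Prod>w\<in>V. real (card (A w)) / q) = 1 / q ^ 2 * (1 - 1 / q) ^ card N" by simp
  \<comment> \<open>Bernoulli: with \<open>q = 2 * D\<close> colours, avoiding colour 0 on at most
    \<open>D\<close> vertices keeps at least half of the colourings.\<close>
  have "1 / 2 \<le> 1 + real D * (- 1 / q)" using V(7) by (simp add: q_def)
  also have "\<dots> \<le> (1 + (- 1 / q)) ^ D"
    by (rule Bernoulli_inequality) (use q in \<open>simp add: field_simps\<close>)
  also have "\<dots> = (1 - 1 / q) ^ D" by simp
  also have "\<dots> \<le> (1 - 1 / q) ^ card N"
    using q V(6) by (intro power_decreasing) (auto simp: field_simps)
  finally have half: "1 / 2 \<le> (1 - 1 / q) ^ card N" .
  have "1 / (8 * real D ^ 2) = 1 / q ^ 2 * (1 / 2)" by (simp add: q_def power2_eq_square)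
  also have "\<dots> \<le> 1 / q ^ 2 * (1 - 1 / q) ^ card N"
    using half by (intro mult_left_mono) auto
  also have "\<dots> = real (card (Pi\<^sub>E V A)) / q ^ card V"
    unfolding prod[symmetric] using V(1) by (simp add: prod_dividef card_PiE)
  finally have "1 / (8 * real D ^ 2) * q ^ card V \<le> card (Pi\<^sub>E V A)"
    using q by (simp add: field_simps)
  moreover have "real (card (V \<rightarrow>\<^sub>E {..<2 * D})) = q ^ card V"
    using V(1) by (simp add: card_PiE q_def)
  moreover have "card (Pi\<^sub>E V A) \<le>
      card {f \<in> V \<rightarrow>\<^sub>E {..<2 * D}. f u = 0 \<and> f v = 0 \<and> (\<forall>w\<in>N. f w \<noteq> 0)}"
    using finite_PiE[OF V(1), of "\<lambda>_. {..<2 * D}"] by (intro card_mono sub) simp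
  ultimately show ?thesis by simp
qed

text \<open>Greedy covering with colourings as choices and the triples \<open>(u, v, N)\<close> as
  requirements; once fewer than one triple is left open, none is.\<close>

lemma isolating_family_exists:
  assumes "finite V" "2 \<le> card V" "1 \<le> D"
  shows "\<exists>Ss. isolating_family V D Ss \<and> (\<forall>S\<in>set Ss. S \<subseteq> V) \<and>
    length Ss \<le> 34 * real D ^ 3 * log 2 (card V)"
proof -
  define n where "n = card V"
  define X where "X = V \<rightarrow>\<^sub>E {..<2 * D}"
  define R where "R = {(u, v, N). u \<in> V \<and> v \<in> V \<and> u \<noteq> v \<and> N \<subseteq> V - {u, v} \<and> card N \<le> D}"
  define P where "P f r = (case r of (u, v, N) \<Rightarrow> f u = 0 \<and> f v = 0 \<and> (\<forall>w\<in>N. f w \<noteq> 0))"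
    for f :: "'a \<Rightarrow> nat" and r
  define \<delta> where "\<delta> = 1 / (8 * real D ^ 2)"
  have D2: "1 \<le> real D ^ 2" using assms(3) by simp
  have "0 < \<delta>" using assms(3) by (simp add: \<delta>_def)
  moreover have "\<delta> \<le> 1" unfolding \<delta>_def using D2 by (subst divide_le_eq_1_pos) linarith+
  ultimately have \<delta>: "0 < \<delta>" "\<delta> \<le> 1" by auto
  have Rsub: "R \<subseteq> V \<times> V \<times> {N. N \<subseteq> V \<and> card N \<le> D}" by (auto simp: R_def)
  have fin: "finite (V \<times> V \<times> {N. N \<subseteq> V \<and> card N \<le> D})"
    using assms(1) by (auto intro: finite_subset[of _ "Pow V"])
  have fR: "finite R" using Rsub fin by (rule finite_subset)
  have "card R \<le> card (V \<times> V \<times> {N. N \<subseteq> V \<and> card N \<le> D})" using fin Rsub by (rule card_mono)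
  also have "\<dots> = n * (n * card {N. N \<subseteq> V \<and> card N \<le> D})" by (simp add: card_cartesian_product n_def)
  also have "\<dots> \<le> n * (n * n ^ Suc D)"
    using card_bounded_subsets_le[OF assms(1,2)] by (intro mult_le_mono2) (simp add: n_def)
  also have "\<dots> = n ^ (D + 3)" by (simp add: eval_nat_numeral)
  finally have cR: "card R \<le> n ^ (D + 3)" .
  have cov: "\<delta> * card X \<le> card {x \<in> X. P x r}" if "r \<in> R" for r
  proof -
    obtain u v N where r: "r = (u, v, N)" by (cases r) auto
    have "1 / (8 * real D ^ 2) * card (V \<rightarrow>\<^sub>E {..<2 * D}) \<le>
      card {f \<in> V \<rightarrow>\<^sub>E {..<2 * D}. f u = 0 \<and> f v = 0 \<and> (\<forall>w\<in>N. f w \<noteq> 0)}"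
      using that assms by (intro card_isolating_colourings) (auto simp: r R_def)
    then show ?thesis by (simp add: \<delta>_def X_def P_def r)
  qed
  \<comment> \<open>With this \<open>a\<close>, \<open>exp (- (\<delta> * a))\<close> equals
    \<open>1 / n ^ (D + 3)\<close>, the inverse of the bound on \<open>card R\<close>. The
    \<open>+ 1\<close> in \<open>t\<close> makes \<open>t > a\<close> strict.\<close>
  define a where "a = 8 * real D ^ 2 * (real D + 3) * ln (real n)"
  define t where "t = nat \<lceil>a\<rceil> + 1"
  have n2: "n \<ge> 2" using assms(2) by (simp add: n_def)
  have a0: "a \<ge> 0" using n2 by (simp add: a_def)
  have ta: "a < real t" "real t \<le> a + 2" using a0 by (auto simp: t_def) linarith+
  have "{..<2 * D} \<noteq> {}" using assms(3) by (auto simp: lessThan_empty_iff)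
  then have "finite X" "X \<noteq> {}"
    using assms(1) by (auto simp: X_def PiE_eq_empty_iff intro: finite_PiE)
  then obtain xs where xs: "set xs \<subseteq> X" "length xs = t"
    and le: "card {r \<in> R. \<forall>x \<in> set xs. \<not> P x r} \<le> (1 - \<delta>) ^ t * card R"
    using greedy_cover[of X R \<delta> P t] fR \<delta>(2) cov by blast
  have "(1 - \<delta>) ^ t \<le> exp (- \<delta>) ^ t"
    using \<delta> exp_ge_add_one_self[of "- \<delta>"] by (intro power_mono) auto
  also have "\<dots> = exp (- (\<delta> * t))" by (simp add: exp_of_nat_mult[symmetric] mult.commute)
  also have "\<dots> < exp (- (\<delta> * a))" using ta \<delta> by simp
  also have "\<delta> * a = (real D + 3) * ln (real n)" using assms(3) by (simp add: \<delta>_def a_def)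
  also have "exp (- ((real D + 3) * ln (real n))) = 1 / exp (real (D + 3) * ln (real n))"
    by (simp add: exp_minus inverse_eq_divide)
  also have "\<dots> = 1 / real n ^ (D + 3)"
    using n2 by (simp only: exp_of_nat_mult) simp
  finally have small: "(1 - \<delta>) ^ t * real n ^ (D + 3) < 1" using n2 by (simp add: field_simps)
  have "(1 - \<delta>) ^ t * card R \<le> (1 - \<delta>) ^ t * real n ^ (D + 3)"
    using cR \<delta> by (intro mult_left_mono) (auto simp flip: of_nat_power)
  then have "real (card {r \<in> R. \<forall>x \<in> set xs. \<not> P x r}) < 1" using le small by linarith
  then have "{r \<in> R. \<forall>x \<in> set xs. \<not> P x r} = {}" using fR by simp
  then have covered: "\<exists>f\<in>set xs. P f r" if "r \<in> R" for r using that by blast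
  define Ss where "Ss = map (\<lambda>f. {w \<in> V. f w = 0}) xs"
  have "isolating_family V D Ss"
    unfolding isolating_family_def
  proof (intro ballI allI impI)
    fix u v N assume "u \<in> V" "v \<in> V" "N \<subseteq> V - {u, v}" "u \<noteq> v \<and> card N \<le> D"
    moreover from this obtain f where "f \<in> set xs" "f u = 0" "f v = 0" "\<forall>w\<in>N. f w \<noteq> 0"
      using covered[of "(u, v, N)"] by (auto simp: R_def P_def)
    ultimately show "\<exists>S\<in>set Ss. u \<in> S \<and> v \<in> S \<and> S \<inter> N = {}"
      by (intro bexI[of _ "{w \<in> V. f w = 0}"]) (auto simp: Ss_def)
  qed
  moreover have "\<forall>S\<in>set Ss. S \<subseteq> V" by (auto simp: Ss_def)
  moreover have "length Ss \<le> 34 * real D ^ 3 * log 2 (card V)"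
  proof -
    have l: "ln (real n) \<le> log 2 n" "1 \<le> log 2 n"
    proof -
      have "ln (2::real) \<le> 1" using ln_le_minus_one[of "2::real"] by simp
      then have "ln (real n) * ln 2 \<le> ln (real n) * 1" using n2 by (intro mult_left_mono) auto
      then show "ln (real n) \<le> log 2 n" by (simp add: log_def field_simps)
      show "1 \<le> log 2 n" using n2 by simp
    qed
    have D3: "1 \<le> real D ^ 3" using assms(3) by simp
    \<comment> \<open>\<open>D + 3 \<le> 4 * D\<close> bounds \<open>a\<close> by 32 times
      \<open>D ^ 3 * log 2 n\<close>; rounding up to \<open>t\<close> costs at most 2 more, hence
      34.\<close>
    have "a \<le> 8 * real D ^ 2 * (4 * real D) * log 2 n"
      unfolding a_def using l assms(3) n2 by (intro mult_mono) auto
    moreover have "1 * 1 \<le> real D ^ 3 * log 2 n"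
      using D3 l by (intro mult_mono) auto
    ultimately show ?thesis
      using ta xs(2) by (simp add: Ss_def n_def power2_eq_square power3_eq_cube)
  qed
  ultimately show ?thesis by blast
qed

section \<open>Degeneracy\<close>

lemma simple_graph_finite_edges:
  assumes "simple_graph V E" shows "finite E"
proof -
  have "E \<subseteq> Pow V" using assms by (auto simp: simple_graph_def)
  then show ?thesis using assms by (meson finite_Pow_iff finite_subset simple_graph_def)
qed

lemma simple_graph_edge_cases:
  assumes "simple_graph V E" "e \<in> E" "v \<in> e"
  obtains w where "e = {v, w}" "w \<noteq> v" "w \<in> V"
proof -
  obtain x y where "e = {x, y}" "x \<noteq> y" "x \<in> V" "y \<in> V"
    using assms(1,2) by (auto simp: simple_graph_def card_2_iff)
  then show thesis using that assms(3) by (metis insertE insert_commute singletonD)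
qed

lemma simple_graph_subset:
  "simple_graph V E \<Longrightarrow> W \<subseteq> V \<Longrightarrow> simple_graph W (induced_edges E W)"
  by (auto simp: simple_graph_def induced_edges_def intro: finite_subset)

lemma vertex_degree_le_card:
  assumes "simple_graph V E" "v \<in> V"
  shows "vertex_degree E v \<le> card V - 1"
proof -
  have fin: "finite V" using assms(1) by (simp add: simple_graph_def)
  have "{e \<in> E. v \<in> e} \<subseteq> (\<lambda>w. {v, w}) ` (V - {v})"
    by (auto elim: simple_graph_edge_cases[OF assms(1)])
  then have "card {e \<in> E. v \<in> e} \<le> card (V - {v})"
    using fin by (intro surj_card_le[where f = "\<lambda>w. {v, w}"]) auto
  then show ?thesis using assms fin by (simp add: vertex_degree_def)
qed

lemma card_neighbours_le_degree:
  assumes "finite E"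
  shows "card {w. {v, w} \<in> E} \<le> vertex_degree E v"
  unfolding vertex_degree_def
  by (rule card_inj_on_le[of "\<lambda>w. {v, w}"]) (use assms in \<open>auto simp: inj_on_def doubleton_eq_iff\<close>)

definition degenerate :: "nat \<Rightarrow> 'a set \<Rightarrow> 'a set set \<Rightarrow> bool" where
  "degenerate d V E \<longleftrightarrow>
     (\<forall>S\<subseteq>V. S \<noteq> {} \<longrightarrow> (\<exists>v\<in>S. vertex_degree (induced_edges E S) v \<le> d))"

text \<open>Supplies a witness for the \<open>LEAST\<close> in \<open>degeneracy\<close>: a vertex
  has at most \<open>card S - 1\<close> neighbours inside \<open>S\<close>.\<close>

lemma degenerate_card:
  assumes "simple_graph V E"
  shows "degenerate (card V - 1) V E"
  unfolding degenerate_def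
proof (intro allI impI)
  fix S assume S: "S \<subseteq> V" "S \<noteq> {}"
  then obtain v where v: "v \<in> S" by blast
  have "vertex_degree (induced_edges E S) v \<le> card S - 1"
    using vertex_degree_le_card[OF simple_graph_subset[OF assms S(1)] v] .
  also have "\<dots> \<le> card V - 1"
    using S(1) assms by (intro diff_le_mono card_mono) (auto simp: simple_graph_def)
  finally show "\<exists>v\<in>S. vertex_degree (induced_edges E S) v \<le> card V - 1" using v by blast
qed

lemma degenerate_degeneracy:
  assumes "simple_graph V E"
  shows "degenerate (degeneracy V E) V E"
proof -
  have eq: "degeneracy V E = (LEAST d. degenerate d V E)"
    by (simp add: degeneracy_def degenerate_def)
  show ?thesis unfolding eq using degenerate_card[OF assms] by (rule LeastI)
qed

lemma degeneracy_le_card: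
  assumes "simple_graph V E"
  shows "degeneracy V E \<le> card V - 1"
proof -
  have eq: "degeneracy V E = (LEAST d. degenerate d V E)"
    by (simp add: degeneracy_def degenerate_def)
  show ?thesis unfolding eq using degenerate_card[OF assms] by (rule Least_le)
qed

text \<open>Deleting a vertex of degree at most \<open>d\<close> loses at most \<open>d\<close>
  edges, and degeneracy supplies such a vertex until none is left. The assumption
  \<open>{} \<notin> E\<close> settles the empty vertex set.\<close>

lemma degenerate_card_edges_le:
  assumes "finite E" "finite W" "degenerate d V E" "W \<subseteq> V" "{} \<notin> E"
  shows "card (induced_edges E W) \<le> d * card W"
  using assms(2,4)
proof (induction "card W" arbitrary: W)
  case 0
  then have "induced_edges E W = {}" using assms(5) by (auto simp: induced_edges_def)
  then show ?case by simp
next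
  case (Suc m)
  then have "W \<noteq> {}" by auto
  then obtain v where v: "v \<in> W" "vertex_degree (induced_edges E W) v \<le> d"
    using assms(3) Suc.prems(2) by (auto simp: degenerate_def)
  have "induced_edges E W = induced_edges E (W - {v}) \<union> {e \<in> induced_edges E W. v \<in> e}"
    by (auto simp: induced_edges_def)
  then have "card (induced_edges E W) \<le>
      card (induced_edges E (W - {v})) + vertex_degree (induced_edges E W) v"
    by (metis card_Un_le vertex_degree_def)
  also have "card (induced_edges E (W - {v})) \<le> d * card (W - {v})"
    using Suc v(1) by (intro Suc.hyps) auto
  finally have "card (induced_edges E W) \<le> d * card (W - {v}) + d" using v(2) by linarith
  also have "\<dots> = d * card W" using card.remove[OF Suc.prems(1) v(1)] by simp
  finally show ?case .
qed

text \<open>Markov's inequality on degrees: they sum to twice the number of edges, so to at most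
  \<open>2 * d * card W\<close>, which leaves room for at most half of the vertices above
  \<open>4 * d\<close>.\<close>

lemma degenerate_high_degree_le:
  assumes "simple_graph V E" "degenerate d V E" "1 \<le> d" "W \<subseteq> V"
  shows "2 * card {v \<in> W. \<not> vertex_degree (induced_edges E W) v \<le> 4 * d} \<le> card W"
proof -
  let ?F = "induced_edges E W" and ?H = "{v \<in> W. \<not> vertex_degree (induced_edges E W) v \<le> 4 * d}"
  have fW: "finite W" using assms(1,4) by (auto simp: simple_graph_def intro: finite_subset)
  have sg: "simple_graph W ?F" using simple_graph_subset[OF assms(1,4)] .
  have fF: "finite ?F" using simple_graph_finite_edges[OF sg] .
  have "4 * d * card ?H = (\<Sum>v\<in>?H. 4 * d)" by simp
  also have "\<dots> \<le> (\<Sum>v\<in>?H. vertex_degree ?F v)" by (intro sum_mono) auto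
  also have "\<dots> \<le> (\<Sum>v\<in>W. vertex_degree ?F v)" using fW by (intro sum_mono2) auto
  also have "\<dots> = (\<Sum>e\<in>?F. card {v \<in> W. v \<in> e})"
    unfolding vertex_degree_def using fW fF by (rule sum_multicount_gen) simp
  also have "\<dots> = (\<Sum>e\<in>?F. 2)"
  proof (rule sum.cong)
    fix e assume "e \<in> ?F"
    then have "{v \<in> W. v \<in> e} = e" "card e = 2" using sg by (auto simp: simple_graph_def)
    then show "card {v \<in> W. v \<in> e} = 2" by simp
  qed simp
  also have "\<dots> = 2 * card ?F" by simp
  also have "\<dots> \<le> 2 * (d * card W)"
    using degenerate_card_edges_le[OF simple_graph_finite_edges[OF assms(1)] fW assms(2,4)] assms(1)
    by (force simp: simple_graph_def)
  finally have "(2 * d) * (2 * card ?H) \<le> (2 * d) * card W" by (simp add: algebra_simps)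
  then show ?thesis using assms(3) by simp
qed

section \<open>Candidate edges\<close>

text \<open>Adjacent vertices share a component of every query containing both, so no answer can
  rule out a true edge.\<close>

lemma cc_oracle_edge:
  assumes "{u, v} \<in> E" "u \<in> S" "v \<in> S"
  shows "\<exists>B \<in> cc_oracle E S. u \<in> B \<and> v \<in> B"
proof -
  let ?r = "connected_in S (induced_edges E S)"
  have "(u, u) \<in> ?r" using assms by (simp add: connected_in_def)
  moreover have "(u, v) \<in> ?r"
    using assms by (auto simp: connected_in_def induced_edges_def)
  moreover have "?r `` {u} \<in> cc_oracle E S"
    using assms by (auto simp: cc_oracle_def connected_components_def quotient_def)
  ultimately show ?thesis by blast
qed

text \<open>A path from \<open>v\<close> to \<open>u\<close> within \<open>S\<close> starts with an
  edge at \<open>v\<close>. Contrapositively, a query without neighbours of \<open>v\<close>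
  separates \<open>v\<close> from everything else in it.\<close>

lemma cc_oracle_isolated:
  assumes "B \<in> cc_oracle E S" "u \<in> B" "v \<in> B" "u \<noteq> v"
  shows "\<exists>w\<in>S. {v, w} \<in> E"
proof -
  let ?s = "{(x, y). {x, y} \<in> induced_edges E S}"
  obtain x where "(x, u) \<in> ?s\<^sup>*" "(x, v) \<in> ?s\<^sup>*"
    using assms by (auto simp: cc_oracle_def connected_components_def quotient_def connected_in_def)
  \<comment> \<open>The component is given through a representative \<open>x\<close>, so the path
    from \<open>x\<close> to \<open>v\<close> has to be reversed.\<close>
  moreover have "sym ?s" by (auto simp: sym_def insert_commute)
  then have "sym (?s\<^sup>*)" by (rule sym_rtrancl)
  ultimately have "(v, u) \<in> ?s\<^sup>*" by (meson rtrancl_trans symD)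
  then obtain y where "(v, y) \<in> ?s" using assms(4) by (metis converse_rtranclE)
  then show ?thesis by (auto simp: induced_edges_def)
qed

text \<open>The pairs in \<open>W\<close> that no query separates, where \<open>Ps\<close> lists the answers to the queries \<open>Ss\<close>.\<close>

definition candidates :: "'a set \<Rightarrow> 'a set list \<Rightarrow> 'a set set list \<Rightarrow> 'a set set" where
  "candidates W Ss Ps = {{u, v} |u v. u \<in> W \<and> v \<in> W \<and> u \<noteq> v \<and>
     (\<forall>(S, P) \<in> set (zip Ss Ps). u \<in> S \<and> v \<in> S \<longrightarrow> (\<exists>B\<in>P. u \<in> B \<and> v \<in> B))}"

lemma candidates_map:
  "candidates W Ss (map orc Ss) = {{u, v} |u v. u \<in> W \<and> v \<in> W \<and> u \<noteq> v \<and>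
     (\<forall>S\<in>set Ss. u \<in> S \<and> v \<in> S \<longrightarrow> (\<exists>B\<in>orc S. u \<in> B \<and> v \<in> B))}"
proof -
  have "(\<forall>(S, P) \<in> set (zip Ss (map orc Ss)). Q S P) \<longleftrightarrow> (\<forall>S\<in>set Ss. Q S (orc S))" for Q
    by (induction Ss) auto
  then show ?thesis by (simp only: candidates_def)
qed

lemma induced_edges_subset_candidates:
  assumes "simple_graph V E"
  shows "induced_edges E W \<subseteq> candidates W Ss (map (cc_oracle E) Ss)"
proof
  fix e assume e: "e \<in> induced_edges E W"
  then obtain u v where uv: "e = {u, v}" "u \<noteq> v" "u \<in> W" "v \<in> W" "{u, v} \<in> E"
    using assms by (auto simp: simple_graph_def induced_edges_def card_2_iff)
  have "\<forall>S\<in>set Ss. u \<in> S \<and> v \<in> S \<longrightarrow> (\<exists>B\<in>cc_oracle E S. u \<in> B \<and> v \<in> B)"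
    using cc_oracle_edge[OF uv(5)] by simp
  then show "e \<in> candidates W Ss (map (cc_oracle E) Ss)"
    unfolding candidates_map mem_Collect_eq using uv(1-4) by (intro exI[of _ u] exI[of _ v] conjI)
qed

lemma candidates_finite: "finite W \<Longrightarrow> finite (candidates W Ss Ps)"
  by (rule finite_subset[of _ "Pow W"]) (auto simp: candidates_def)

text \<open>A single query that isolates \<open>v\<close> and contains \<open>u\<close> refutes a
  false pair. The premise \<open>iso\<close> is abstract so that it serves both the isolating family
  and the pair queries.\<close>

lemma candidates_sound:
  assumes iso: "\<And>u. u \<in> W \<Longrightarrow> u \<noteq> v \<Longrightarrow> {u, v} \<notin> E \<Longrightarrow>
      \<exists>S\<in>set Ss. u \<in> S \<and> v \<in> S \<and> (\<forall>w\<in>S. {v, w} \<notin> E)"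
    and e: "e \<in> candidates W Ss (map (cc_oracle E) Ss)" "v \<in> e"
  shows "e \<in> induced_edges E W"
proof -
  \<comment> \<open>Orients the unordered pair so that \<open>v\<close> is the second endpoint, the
    one about which \<open>iso\<close> speaks.\<close>
  have "\<exists>u. e = {u, v} \<and> u \<in> W \<and> v \<in> W \<and> u \<noteq> v \<and>
    (\<forall>S\<in>set Ss. u \<in> S \<and> v \<in> S \<longrightarrow> (\<exists>B\<in>cc_oracle E S. u \<in> B \<and> v \<in> B))"
  proof -
    obtain x y where xy: "e = {x, y}" "x \<in> W" "y \<in> W" "x \<noteq> y"
      "\<forall>S\<in>set Ss. x \<in> S \<and> y \<in> S \<longrightarrow> (\<exists>B\<in>cc_oracle E S. x \<in> B \<and> y \<in> B)"
      using e(1) unfolding candidates_map mem_Collect_eq by (elim exE conjE)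
    show ?thesis
    proof (cases "v = y")
      case True
      then show ?thesis using xy by (intro exI[of _ x]) simp
    next
      case False
      then have "v = x" using xy(1) e(2) by simp
      then show ?thesis using xy by (intro exI[of _ y]) (simp add: insert_commute conj_commute)
    qed
  qed
  then obtain u where u: "e = {u, v}" "u \<in> W" "v \<in> W" "u \<noteq> v"
    "\<And>S. S \<in> set Ss \<Longrightarrow> u \<in> S \<Longrightarrow> v \<in> S \<Longrightarrow> \<exists>B\<in>cc_oracle E S. u \<in> B \<and> v \<in> B"
    by blast
  have "{u, v} \<in> E"
  proof (rule ccontr)
    assume "{u, v} \<notin> E"
    then obtain S where "S \<in> set Ss" "u \<in> S" "v \<in> S" "\<forall>w\<in>S. {v, w} \<notin> E"
      using iso u by blast
    then show False using u(4,5) cc_oracle_isolated by metis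
  qed
  then show ?thesis using u by (simp add: induced_edges_def)
qed

text \<open>Cutting the queries down to \<open>W\<close> removes the neighbours of \<open>v\<close>
  outside \<open>W\<close>, so the family has to avoid only those inside, and there are at most
  \<open>D\<close> of them.\<close>

lemma candidates_low_degree:
  assumes sg: "simple_graph V E" and W: "W \<subseteq> V" and fam: "isolating_family V D Ss"
    and v: "v \<in> W" "vertex_degree (induced_edges E W) v \<le> D"
    and Ts: "Ts = map (\<lambda>S. S \<inter> W) Ss"
    and e: "e \<in> candidates W Ts (map (cc_oracle E) Ts)" "v \<in> e"
  shows "e \<in> induced_edges E W"
proof (rule candidates_sound[OF _ e])
  fix u assume u: "u \<in> W" "u \<noteq> v" "{u, v} \<notin> E"
  define N where "N = {w. {v, w} \<in> induced_edges E W}"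
  have "finite (induced_edges E W)"
    using simple_graph_finite_edges[OF simple_graph_subset[OF sg W]] .
  then have "card N \<le> D"
    unfolding N_def using v(2) by (rule order_trans[OF card_neighbours_le_degree])
  moreover have "{v, v} \<notin> E" using sg by (auto simp: simple_graph_def)
  then have "N \<subseteq> V - {u, v}"
    using u W by (auto simp: N_def induced_edges_def insert_commute)
  ultimately obtain S where S: "S \<in> set Ss" "u \<in> S" "v \<in> S" "S \<inter> N = {}"
    using fam[unfolded isolating_family_def, rule_format, of u v N] u(1,2) v(1) W by blast
  then have "\<forall>w\<in>S \<inter> W. {v, w} \<notin> E" using v(1) by (auto simp: N_def induced_edges_def)
  then show "\<exists>S\<in>set Ts. u \<in> S \<and> v \<in> S \<and> (\<forall>w\<in>S. {v, w} \<notin> E)"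
    using S u v(1) by (auto simp: Ts)
qed

section \<open>The peeling algorithm\<close>

primrec query_all :: "'a set list \<Rightarrow> ('a set set list \<Rightarrow> 'a cc_algorithm) \<Rightarrow> 'a cc_algorithm" where
  "query_all [] k = k []"
| "query_all (S # Ss) k = Query S (\<lambda>P. query_all Ss (\<lambda>Ps. k (P # Ps)))"

lemma alg_output_query_all [simp]:
  "alg_output orc (query_all Ss k) = alg_output orc (k (map orc Ss))"
  by (induction Ss arbitrary: k) auto

lemma alg_queries_query_all [simp]:
  "alg_queries orc (query_all Ss k) = Ss @ alg_queries orc (k (map orc Ss))"
  by (induction Ss arbitrary: k) auto

text \<open>Sorting fixes one deterministic order. Singletons and both orientations are included,
  which makes the count exactly \<open>card W ^ 2\<close>.\<close>

definition pair_queries :: "'a::linorder set \<Rightarrow> 'a set list" where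
  "pair_queries W =
     map (\<lambda>(u, v). {u, v}) (List.product (sorted_list_of_set W) (sorted_list_of_set W))"

lemma set_pair_queries: "finite W \<Longrightarrow> set (pair_queries W) = (\<lambda>(u, v). {u, v}) ` (W \<times> W)"
  by (simp add: pair_queries_def)

lemma length_pair_queries: "length (pair_queries W) = card W ^ 2"
  by (simp add: pair_queries_def power2_eq_square)

text \<open>The query \<open>{u, v}\<close> itself isolates \<open>v\<close> when the two are not
  adjacent, because there are no loops.\<close>

lemma candidates_pair_queries:
  assumes sg: "simple_graph V E" and W: "W \<subseteq> V"
  shows "candidates W (pair_queries W) (map (cc_oracle E) (pair_queries W)) = induced_edges E W"
proof (rule antisym)
  have fW: "finite W" using assms by (auto simp: simple_graph_def intro: finite_subset)
  show "candidates W (pair_queries W) (map (cc_oracle E) (pair_queries W)) \<subseteq> induced_edges E W"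
  proof
    fix e assume e: "e \<in> candidates W (pair_queries W) (map (cc_oracle E) (pair_queries W))"
    then obtain v where v: "v \<in> e" "v \<in> W" by (auto simp: candidates_def)
    show "e \<in> induced_edges E W"
    proof (rule candidates_sound[OF _ e v(1)])
      fix u assume u: "u \<in> W" "u \<noteq> v" "{u, v} \<notin> E"
      have "{v, v} \<notin> E" using sg by (auto simp: simple_graph_def)
      then have "\<forall>w\<in>{u, v}. {v, w} \<notin> E" using u by (auto simp: insert_commute)
      moreover have "{u, v} \<in> set (pair_queries W)"
        using u v fW by (auto simp: set_pair_queries)
      ultimately show "\<exists>S\<in>set (pair_queries W). u \<in> S \<and> v \<in> S \<and> (\<forall>w\<in>S. {v, w} \<notin> E)" by blast
    qed
  qed
qed (rule induced_edges_subset_candidates[OF sg])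

text \<open>The parameter \<open>K\<close> accumulates the edges found and \<open>W\<close> is the set of remaining vertices.\<close>

primrec peel :: "nat \<Rightarrow> 'a::linorder set list \<Rightarrow> nat \<Rightarrow> 'a set set \<Rightarrow> 'a set \<Rightarrow> 'a cc_algorithm" where
  "peel D Ss 0 K W =
     query_all (pair_queries W) (\<lambda>Ps. Output (K \<union> candidates W (pair_queries W) Ps))"
| "peel D Ss (Suc k) K W =
     query_all (map (\<lambda>S. S \<inter> W) Ss) (\<lambda>Ps.
       let C = candidates W (map (\<lambda>S. S \<inter> W) Ss) Ps;
           L = {v \<in> W. vertex_degree C v \<le> D}
       in peel D Ss k (K \<union> {e \<in> C. e \<inter> L \<noteq> {}}) (W - L))"

text \<open>The algorithm sees \<open>C\<close>, not the hidden degrees. Degrees in \<open>C\<close>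
  dominate the true ones, and at a vertex of true degree at most \<open>D\<close> the candidates are
  exactly the edges, so both thresholds select the same vertices.\<close>

lemma peel_round:
  assumes sg: "simple_graph V E" and W: "W \<subseteq> V" and fam: "isolating_family V D Ss"
    and Ts: "Ts = map (\<lambda>S. S \<inter> W) Ss"
    and C: "C = candidates W Ts (map (cc_oracle E) Ts)"
    and L: "L = {v \<in> W. vertex_degree C v \<le> D}"
  shows "L = {v \<in> W. vertex_degree (induced_edges E W) v \<le> D}"
    and "{e \<in> C. e \<inter> L \<noteq> {}} = {e \<in> induced_edges E W. e \<inter> L \<noteq> {}}"
proof -
  have fW: "finite W" using sg W by (auto simp: simple_graph_def intro: finite_subset)
  have sub: "induced_edges E W \<subseteq> C" unfolding C by (rule induced_edges_subset_candidates[OF sg])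
  have fC: "finite C" unfolding C using fW by (rule candidates_finite)
  have low: "e \<in> induced_edges E W"
    if "v \<in> W" "vertex_degree (induced_edges E W) v \<le> D" "e \<in> C" "v \<in> e" for v e
    using candidates_low_degree[OF sg W fam that(1,2) Ts] that(3,4) C by blast
  show Leq: "L = {v \<in> W. vertex_degree (induced_edges E W) v \<le> D}"
  proof (intro set_eqI iffI)
    fix v assume v: "v \<in> L"
    have "vertex_degree (induced_edges E W) v \<le> vertex_degree C v"
      unfolding vertex_degree_def using sub fC by (intro card_mono) auto
    then show "v \<in> {v \<in> W. vertex_degree (induced_edges E W) v \<le> D}" using v L by auto
  next
    fix v assume v: "v \<in> {v \<in> W. vertex_degree (induced_edges E W) v \<le> D}"
    then have "{e \<in> C. v \<in> e} = {e \<in> induced_edges E W. v \<in> e}" using low sub by blast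
    then show "v \<in> L" using v L by (simp add: vertex_degree_def)
  qed
  show "{e \<in> C. e \<inter> L \<noteq> {}} = {e \<in> induced_edges E W. e \<inter> L \<noteq> {}}"
    using low sub Leq by blast
qed

text \<open>Induction on the rounds left: each round halves the bound on \<open>W\<close>, edges
  touching a removed vertex move into \<open>K\<close>, and all others survive in the smaller set.
  At \<open>k = 0\<close> fewer than \<open>2 * d\<close> vertices remain, costing at most
  \<open>4 * d ^ 2\<close> pair queries.\<close>

lemma peel_correct:
  assumes sg: "simple_graph V E" and deg: "degenerate d V E" and d: "1 \<le> d"
    and fam: "isolating_family V (4 * d) Ss"
    and "W \<subseteq> V" "card W < 2 ^ Suc k * d"
  shows "alg_output (cc_oracle E) (peel (4 * d) Ss k K W) = K \<union> induced_edges E W \<and>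
    (\<forall>S \<in> set (alg_queries (cc_oracle E) (peel (4 * d) Ss k K W)). S \<subseteq> V) \<and>
    length (alg_queries (cc_oracle E) (peel (4 * d) Ss k K W)) \<le> k * length Ss + 4 * d ^ 2"
  using assms(5,6)
proof (induction k arbitrary: K W)
  case 0
  have "card W ^ 2 \<le> (2 * d) ^ 2" using 0 by (intro power_mono) auto
  moreover have "finite W" using sg 0 by (auto simp: simple_graph_def intro: finite_subset)
  ultimately show ?case
    using 0 by (auto simp: candidates_pair_queries[OF sg] length_pair_queries set_pair_queries
      power_mult_distrib)
next
  case (Suc k)
  define Ts where "Ts = map (\<lambda>S. S \<inter> W) Ss"
  define C where "C = candidates W Ts (map (cc_oracle E) Ts)"
  define L where "L = {v \<in> W. vertex_degree C v \<le> 4 * d}"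
  note round = peel_round[OF sg Suc.prems(1) fam Ts_def C_def L_def]
  let ?K = "K \<union> {e \<in> C. e \<inter> L \<noteq> {}}"
  have "W - L = {v \<in> W. \<not> vertex_degree (induced_edges E W) v \<le> 4 * d}"
    using round(1) by blast
  then have "2 * card (W - L) \<le> card W"
    using degenerate_high_degree_le[OF sg deg d Suc.prems(1)] by simp
  then have small: "card (W - L) < 2 ^ Suc k * d" using Suc.prems(2) by simp
  have "induced_edges E W = {e \<in> induced_edges E W. e \<inter> L \<noteq> {}} \<union> induced_edges E (W - L)"
    by (auto simp: induced_edges_def)
  then have edges: "?K \<union> induced_edges E (W - L) = K \<union> induced_edges E W"
    using round(2) by blast
  have step: "alg_queries (cc_oracle E) (peel (4 * d) Ss (Suc k) K W) =
      Ts @ alg_queries (cc_oracle E) (peel (4 * d) Ss k ?K (W - L))"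
    "alg_output (cc_oracle E) (peel (4 * d) Ss (Suc k) K W) =
      alg_output (cc_oracle E) (peel (4 * d) Ss k ?K (W - L))"
    by (simp_all add: Let_def Ts_def C_def L_def)
  have "W - L \<subseteq> V" using Suc.prems(1) by blast
  note IH = Suc.IH[OF this small, of ?K]
  have "\<forall>S\<in>set Ts. S \<subseteq> V" "length Ts = length Ss" using Suc.prems(1) by (auto simp: Ts_def)
  then show ?case unfolding step using IH edges by auto
qed

section \<open>Choice of parameters and the query count\<close>

theorem theorem10:
  shows "\<exists>(A :: nat set \<Rightarrow> nat \<Rightarrow> nat cc_algorithm) (C :: real).
    \<forall>(V :: nat set) (E :: nat set set) (n :: nat) (d :: nat).
      simple_graph V E \<and> card V = n \<and> degeneracy V E = d \<longrightarrow>
        reconstructs (A V d) V E \<and>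
        real (num_queries (A V d) E) \<le> C * (real d ^ 3 * log 2 (real n) * log 2 (real n / real d))"
proof -
  \<comment> \<open>The family depends on \<open>V\<close> and \<open>d\<close> alone, so the choice
    by \<open>SOME\<close> yields one fixed decision tree for all hidden graphs on \<open>V\<close>
    of degeneracy \<open>d\<close>.\<close>
  define Fam :: "nat set \<Rightarrow> nat \<Rightarrow> nat set list" where
    "Fam V d = (SOME Ss. isolating_family V (4 * d) Ss \<and> (\<forall>S\<in>set Ss. S \<subseteq> V) \<and>
      length Ss \<le> 34 * real (4 * d) ^ 3 * log 2 (card V))" for V d
  \<comment> \<open>For \<open>d = 0\<close> the claimed bound is 0, so no query may be asked; such
    a graph has no edges.\<close>
  define A :: "nat set \<Rightarrow> nat \<Rightarrow> nat cc_algorithm" where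
    "A V d = (if d = 0 then Output {}
      else peel (4 * d) (Fam V d) (nat \<lfloor>log 2 (card V / d)\<rfloor>) {} V)" for V d
  \<comment> \<open>2184 is \<open>34 * 4 ^ 3 + 8\<close>: the first term pays for the rounds, the 8
    for the final pair queries.\<close>
  have "reconstructs (A V d) V E \<and>
      real (num_queries (A V d) E) \<le> 2184 * (real d ^ 3 * log 2 (real n) * log 2 (real n / real d))"
    if sg: "simple_graph V E" and n: "card V = n" and d: "degeneracy V E = d" for V E n d
  proof -
    have fV: "finite V" using sg by (simp add: simple_graph_def)
    have deg: "degenerate d V E" using degenerate_degeneracy[OF sg] d by simp
    have EV: "induced_edges E V = E" using sg by (auto simp: simple_graph_def induced_edges_def)
    show ?thesis
    proof (cases "d = 0")
      case True
      have "{} \<notin> E" using sg by (auto simp: simple_graph_def)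
      then have "card E = 0"
        using degenerate_card_edges_le[OF simple_graph_finite_edges[OF sg] fV deg] True EV by simp
      then have "E = {}" using simple_graph_finite_edges[OF sg] by simp
      then show ?thesis using True by (simp add: A_def reconstructs_def num_queries_def)
    next
      case False
      then have d1: "1 \<le> d" by simp
      have dn: "d + 1 \<le> n" using degeneracy_le_card[OF sg] d n d1 by simp
      \<comment> \<open>Rounding down keeps \<open>k\<close> within \<open>log 2 (n / d)\<close>,
        while \<open>n < 2 ^ Suc k * d\<close> still holds, as \<open>peel_correct\<close> demands
        at the start.\<close>
      define k where "k = nat \<lfloor>log 2 (real n / real d)\<rfloor>"
      have pos: "0 < log 2 (real n / real d)" using d1 dn by simp
      have k_le: "real k \<le> log 2 (real n / real d)" using pos by (simp add: k_def)
      have "log 2 (real n / real d) < real (Suc k)" using pos by (simp add: k_def) linarith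
      then have "real n / real d < 2 powr real (Suc k)"
        using d1 dn by (subst (asm) log_less_iff) auto
      then have "real n < 2 ^ Suc k * real d"
        using d1 by (simp add: powr_realpow field_simps del: power_Suc of_nat_Suc)
      then have "real n < real (2 ^ Suc k * d)"
        by (simp only: of_nat_mult of_nat_power of_nat_numeral)
      then have nk: "card V < 2 ^ Suc k * d" by (simp only: of_nat_less_iff n)
      have "\<exists>Ss. isolating_family V (4 * d) Ss \<and> (\<forall>S\<in>set Ss. S \<subseteq> V) \<and>
          length Ss \<le> 34 * real (4 * d) ^ 3 * log 2 (card V)"
        using fV d1 dn n by (intro isolating_family_exists) auto
      from someI_ex[OF this, folded Fam_def]
      have fam: "isolating_family V (4 * d) (Fam V d)"
        and len: "length (Fam V d) \<le> 34 * real (4 * d) ^ 3 * log 2 n"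
        by (simp_all only: n)
      have A: "A V d = peel (4 * d) (Fam V d) k {} V"
        using False by (simp add: A_def k_def n)
      note correct = peel_correct[OF sg deg d1 fam order_refl nk, of "{}"]
      have "reconstructs (A V d) V E"
        using correct by (simp add: reconstructs_def A EV)
      moreover have "real (num_queries (A V d) E) \<le>
          2184 * (real d ^ 3 * log 2 (real n) * log 2 (real n / real d))"
      proof -
        have logn: "1 \<le> log 2 (real n)" using d1 dn by simp
        have "num_queries (A V d) E \<le> k * length (Fam V d) + 4 * d ^ 2"
          using correct by (simp add: num_queries_def A)
        then have "real (num_queries (A V d) E) \<le> real (k * length (Fam V d) + 4 * d ^ 2)"
          by (rule of_nat_mono)
        also have "\<dots> = real k * length (Fam V d) + 4 * real d ^ 2" by simp
        also have "real k * length (Fam V d) \<le>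
            log 2 (real n / real d) * (34 * real (4 * d) ^ 3 * log 2 n)"
          using k_le len pos by (intro mult_mono) auto
        \<comment> \<open>\<open>log 2 (n / d)\<close> can be as small as order
          \<open>1 / d\<close>, namely for \<open>n = d + 1\<close>. By
          \<open>ln x \<le> x - 1\<close> at \<open>x = d / n\<close> it is at least
          \<open>1 / (2 * d)\<close>, and the third factor of \<open>d ^ 3\<close> absorbs this
          loss.\<close>
        also have "4 * real d ^ 2 \<le> 8 * (real d ^ 3 * log 2 (real n) * log 2 (real n / real d))"
        proof -
          have "real d / real n \<le> real d / (real d + 1)"
            using d1 dn by (intro divide_left_mono) auto
          also have "\<dots> \<le> 1 - 1 / (2 * real d)" using d1 by (simp add: field_simps)
          finally have "1 / (2 * real d) \<le> 1 - real d / real n" by simp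
          also have "\<dots> \<le> ln (real n / real d)"
            using ln_le_minus_one[of "real d / real n"] d1 dn by (simp add: ln_div)
          also have "\<dots> \<le> log 2 (real n / real d)"
          proof -
            have "ln (2::real) \<le> 1" using ln_le_minus_one[of "2::real"] by simp
            then have "ln (real n / real d) * ln 2 \<le> ln (real n / real d) * 1"
              using d1 dn by (intro mult_left_mono) auto
            then show ?thesis by (simp add: log_def field_simps)
          qed
          finally have l: "1 / (2 * real d) \<le> log 2 (real n / real d)" .
          have "4 * real d ^ 2 = 8 * (real d ^ 3 * 1 * (1 / (2 * real d)))"
            using d1 by (simp add: power2_eq_square power3_eq_cube)
          also have "\<dots> \<le> 8 * (real d ^ 3 * log 2 (real n) * log 2 (real n / real d))"
            using l logn by (intro mult_left_mono mult_mono) auto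
          finally show ?thesis .
        qed
        finally show ?thesis by (simp add: algebra_simps)
      qed
      ultimately show ?thesis by blast
    qed
  qed
  then show ?thesis by blast
qed

end
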